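(* Let $y^i,y^{i+1}$ be two consecutive extreme supported nondominated points of a bi-objective minimum cost integer flow problem with $y^i_1<y^{i+1}_1$, let $\lambda=(y^i_2-y^{i+1}_2,\ y^{i+1}_1-y^i_1)$, let $f'$ be a feasible flow of the reduced network $D'_\lambda$ minimizing $c^1$ over all feasible flows of $D'_\lambda$, let $C$ be a cycle of minimum $c^1$-cost among all cycles in the residual network $D'_{\lambda,f'}$ with strictly positive $c^1$-cost, and let $f''=f'+\chi(C)$. Then there exists no feasible flow $\bar f$ of $D'_\lambda$ (equivalently, no flow whose image lies on the edge $F_i$ between $y^i$ and $y^{i+1}$) with $c^1(f')<c^1(\bar f)<c^1(f'')$.
   Context: Setting: a connected directed graph $D=(V,A)$, finite integer capacities $0\le l_{ij}\le u_{ij}$, integer balances $b_i$, cost vectors $c^1,c^2$; feasible flows are $f\in\mathbb{Z}^A$ with $\sum_{j:(i,j)\in A}f_{ij}-\sum_{j:(j,i)\in A}f_{ji}=b_i$ and $l\le f\le u$, with images $(c^1(f),c^2(f))$, $c^k(f)=\sum c^k_{ij}f_{ij}$. Extreme supported nondominated points are the nondominated vertices of $\mathrm{conv}(\mathcal{Y})+\mathbb{R}^2_{\geq}$, where $\mathcal{Y}$ is the set of images of feasible flows; consecutive means adjacent along this boundary, so the segment $F_i$ between them is a maximal nondominated face. Residual network $D_f$: for $(i,j)\in A$, arc $(i,j)$ with cost $c_{ij}$ if $f_{ij}<u_{ij}$, arc $(j,i)$ with cost $-c_{ij}$ if $f_{ij}>l_{ij}$; cycles are directed cycles not using both residual copies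 of one arc of $D$; $c^1(C)$ is the sum of residual $c^1$-costs. $\chi(C)\in\{-1,0,1\}^A$ has entry $1$ on arcs of $D$ traversed forward by $C$ and $-1$ on arcs traversed backward. Reduced network: take an optimal flow $f^0$ of $\min\{\lambda_1c^1(f)+\lambda_2c^2(f)\}$ and node potentials $y$ satisfying complementary slackness for it, reduced costs $\overline{c}_{ij}=\lambda_1c^1_{ij}+\lambda_2c^2_{ij}+y_i-y_j$, $X=\{(i,j):\overline{c}_{ij}\neq 0\}$; $D'_\lambda=(V,A\setminus X)$ with the same capacities and balances $b'_i=b_i-\sum_{(i,j)\in X}f^0_{ij}+\sum_{(j,i)\in X}f^0_{ji}$. Feasible flows of $D'_\lambda$, extended by $f^0$ on $X$, are exactly the optimal flows of the weighted sum problem with weight $\lambda$, i.e. the flows whose images lie on $F_i$. *)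

theory Defs
  imports
    "HOL-Analysis.Analysis"
    "Graph_Theory.Graph_Theory"
begin

section \<open>Flows in capacitated networks\<close>

text \<open>A flow is a function on all pairs; only its values on the arcs of the network matter.\<close>

type_synonym 'a flow = "'a \<times> 'a \<Rightarrow> int"
type_synonym 'a cost = "'a \<times> 'a \<Rightarrow> real"

record 'a network =
  net_graph :: "'a pair_pre_digraph"
  lower_cap :: "'a flow"
  upper_cap :: "'a flow"
  balance :: "'a \<Rightarrow> int"

abbreviation net_arcs :: "'a network \<Rightarrow> ('a \<times> 'a) set" where
  "net_arcs N \<equiv> parcs (net_graph N)"

text \<open>The name \<open>connected\<close> is qualified because HOL-Analysis uses it for topological connectedness.\<close>

definition flow_network :: "'a network \<Rightarrow> bool" where
  "flow_network N \<longleftrightarrow>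
     pair_fin_digraph (net_graph N) \<and>
     Digraph_Component.connected (with_proj (net_graph N)) \<and>
     (\<forall>a\<in>net_arcs N. 0 \<le> lower_cap N a \<and> lower_cap N a \<le> upper_cap N a)"

definition net_outflow :: "('a \<times> 'a) set \<Rightarrow> 'a flow \<Rightarrow> 'a \<Rightarrow> int" where
  "net_outflow A f i = (\<Sum>j | (i, j) \<in> A. f (i, j)) - (\<Sum>j | (j, i) \<in> A. f (j, i))"

definition feasible_flow :: "'a network \<Rightarrow> 'a flow \<Rightarrow> bool" where
  "feasible_flow N f \<longleftrightarrow>
     (\<forall>i\<in>pverts (net_graph N). net_outflow (net_arcs N) f i = balance N i) \<and>
     (\<forall>a\<in>net_arcs N. lower_cap N a \<le> f a \<and> f a \<le> upper_cap N a)"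

definition flow_cost :: "'a network \<Rightarrow> 'a cost \<Rightarrow> 'a flow \<Rightarrow> real" where
  "flow_cost N c f = (\<Sum>a\<in>net_arcs N. c a * real_of_int (f a))"

definition optimal_flow :: "'a network \<Rightarrow> 'a cost \<Rightarrow> 'a flow \<Rightarrow> bool" where
  "optimal_flow N c f \<longleftrightarrow> is_arg_min (flow_cost N c) (feasible_flow N) f"


section \<open>The bi-objective problem\<close>

definition flow_image :: "'a network \<Rightarrow> 'a cost \<Rightarrow> 'a cost \<Rightarrow> 'a flow \<Rightarrow> real \<times> real" where
  "flow_image N c1 c2 f = (flow_cost N c1 f, flow_cost N c2 f)"

definition image_set :: "'a network \<Rightarrow> 'a cost \<Rightarrow> 'a cost \<Rightarrow> (real \<times> real) set" where
  "image_set N c1 c2 = {flow_image N c1 c2 f | f. feasible_flow N f}"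

definition nondominated :: "(real \<times> real) set \<Rightarrow> real \<times> real \<Rightarrow> bool" where
  "nondominated Y p \<longleftrightarrow>
     p \<in> Y \<and> \<not> (\<exists>q\<in>Y. fst q \<le> fst p \<and> snd q \<le> snd p \<and> q \<noteq> p)"

definition upper_image :: "(real \<times> real) set \<Rightarrow> (real \<times> real) set" where
  "upper_image Y = {p + d | p d. p \<in> convex hull Y \<and> 0 \<le> fst d \<and> 0 \<le> snd d}"

definition extreme_supported_nondominated :: "(real \<times> real) set \<Rightarrow> real \<times> real \<Rightarrow> bool" where
  "extreme_supported_nondominated Y p \<longleftrightarrow>
     nondominated Y p \<and> p extreme_point_of upper_image Y"

text \<open>Two such points are consecutive if they are adjacent vertices of the polyhedron
  \<open>upper_image Y\<close>: the segment joining them is a one-dimensional face.\<close>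

definition consecutive_extreme_supported ::
    "(real \<times> real) set \<Rightarrow> real \<times> real \<Rightarrow> real \<times> real \<Rightarrow> bool" where
  "consecutive_extreme_supported Y p q \<longleftrightarrow>
     extreme_supported_nondominated Y p \<and> extreme_supported_nondominated Y q \<and>
     closed_segment p q edge_of upper_image Y"

definition weighted_cost :: "real \<times> real \<Rightarrow> 'a cost \<Rightarrow> 'a cost \<Rightarrow> 'a cost" where
  "weighted_cost w c1 c2 a = fst w * c1 a + snd w * c2 a"


section \<open>Residual networks and their cycles\<close>

text \<open>Since \<open>(i, j)\<close> and \<open>(j, i)\<close> may both be arcs of the network, the residual network can have
  parallel arcs; a residual arc therefore records the arc it is a copy of.\<close>

datatype 'a residual_arc = Forward "'a \<times> 'a" | Backward "'a \<times> 'a"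

primrec residual_tail :: "'a residual_arc \<Rightarrow> 'a" where
  "residual_tail (Forward a) = fst a"
| "residual_tail (Backward a) = snd a"

primrec residual_head :: "'a residual_arc \<Rightarrow> 'a" where
  "residual_head (Forward a) = snd a"
| "residual_head (Backward a) = fst a"

primrec residual_cost :: "'a cost \<Rightarrow> 'a residual_arc \<Rightarrow> real" where
  "residual_cost c (Forward a) = c a"
| "residual_cost c (Backward a) = - c a"

definition residual_network :: "'a network \<Rightarrow> 'a flow \<Rightarrow> ('a, 'a residual_arc) pre_digraph" where
  "residual_network N f =
     \<lparr> verts = pverts (net_graph N),
       arcs = {Forward a | a. a \<in> net_arcs N \<and> f a < upper_cap N a}
            \<union> {Backward a | a. a \<in> net_arcs N \<and> lower_cap N a < f a},
       tail = residual_tail,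
       head = residual_head \<rparr>"

definition residual_cycle :: "'a network \<Rightarrow> 'a flow \<Rightarrow> 'a residual_arc list \<Rightarrow> bool" where
  "residual_cycle N f C \<longleftrightarrow>
     pre_digraph.cycle (residual_network N f) C \<and>
     \<not> (\<exists>a. Forward a \<in> set C \<and> Backward a \<in> set C)"

definition cycle_cost :: "'a cost \<Rightarrow> 'a residual_arc list \<Rightarrow> real" where
  "cycle_cost c C = (\<Sum>r\<leftarrow>C. residual_cost c r)"

definition cycle_flow :: "'a residual_arc list \<Rightarrow> 'a flow" where
  "cycle_flow C a = (if Forward a \<in> set C then 1 else if Backward a \<in> set C then -1 else 0)"


section \<open>The reduced network\<close>

definition reduced_cost :: "'a cost \<Rightarrow> ('a \<Rightarrow> real) \<Rightarrow> 'a cost" where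
  "reduced_cost c y a = c a + y (fst a) - y (snd a)"

text \<open>Complementary slackness of a flow and of node potentials, the latter entering only through
  the reduced costs \<open>rc\<close>.\<close>

definition complementary_slackness :: "'a network \<Rightarrow> 'a cost \<Rightarrow> 'a flow \<Rightarrow> bool" where
  "complementary_slackness N rc f \<longleftrightarrow>
     (\<forall>a\<in>net_arcs N.
        (0 < rc a \<longrightarrow> f a = lower_cap N a) \<and>
        (lower_cap N a < f a \<and> f a < upper_cap N a \<longrightarrow> rc a = 0) \<and>
        (rc a < 0 \<longrightarrow> f a = upper_cap N a))"

definition fixed_arcs :: "'a network \<Rightarrow> 'a cost \<Rightarrow> ('a \<times> 'a) set" where
  "fixed_arcs N rc = {a \<in> net_arcs N. rc a \<noteq> 0}"

definition reduced_network :: "'a network \<Rightarrow> 'a cost \<Rightarrow> 'a flow \<Rightarrow> 'a network" where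
  "reduced_network N rc f0 = N
     \<lparr> net_graph := (net_graph N) \<lparr> parcs := net_arcs N - fixed_arcs N rc \<rparr>,
       balance := \<lambda>i. balance N i - net_outflow (fixed_arcs N rc) f0 i \<rparr>"

definition extend_flow :: "('a \<times> 'a) set \<Rightarrow> 'a flow \<Rightarrow> 'a flow \<Rightarrow> 'a flow" where
  "extend_flow X f0 f a = (if a \<in> X then f0 a else f a)"

end

theory Submission
  imports Defs
begin

text \<open>For a feasible flow \<open>g\<close> of the reduced network that costs more than \<open>f'\<close>, the circulation
  \<open>g - f'\<close> is a sum of residual cycles of \<open>f'\<close>, all of nonnegative \<open>c1\<close>-cost because \<open>f'\<close> is optimal.
  One of them has positive cost, hence at least the cost of \<open>C\<close>, so \<open>g\<close> costs at least as much as
  \<open>f''\<close>. A flow of the full network whose image lies on the edge is optimal for the weight \<open>lam\<close>; by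
  complementary slackness it agrees with \<open>f0\<close> on the fixed arcs, so it is a feasible flow of the reduced
  network.\<close>


section \<open>Cycles in finite digraphs\<close>

text \<open>Arcs can be followed forever, and a walk with as many arcs as there are vertices repeats
  a vertex, so it contains a cycle.\<close>

lemma (in fin_digraph) ex_cycle_if_arcs_continue:
  assumes "e0 \<in> arcs G"
    and succ: "\<And>e. e \<in> arcs G \<Longrightarrow> \<exists>e'\<in>arcs G. tail G e' = head G e"
  shows "\<exists>p. cycle p"
proof -
  \<comment> \<open>Keeping the end of the walk as the tail of an arc \<open>e\<close> makes it
    extensible: append \<open>e\<close>, then pass to a successor of \<open>e\<close>.\<close>
  have long: "\<exists>u p e. awalk u p (tail G e) \<and> e \<in> arcs G \<and> length p = n" for n
  proof (induction n)
    case 0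
    have "awalk (tail G e0) [] (tail G e0)" using assms(1) by (simp add: awalk_Nil_iff)
    then show ?case using assms(1) by blast
  next
    case (Suc n)
    then obtain u p e where p: "awalk u p (tail G e)" "e \<in> arcs G" "length p = n" by blast
    obtain e' where e': "e' \<in> arcs G" "tail G e' = head G e" using succ p(2) by blast
    have "awalk u (p @ [e]) (tail G e')"
      using p e' by (auto simp: awalk_append_iff awalk_simps awalk_last_in_verts)
    then show ?case using p e' by (metis length_append_singleton)
  qed
  obtain u p v where p: "awalk u p v" "length p = card (verts G)"
    using long[of "card (verts G)"] by blast
  have "\<not> distinct (awalk_verts u p)"
    using length_apath_less[of u p v] p by (auto simp: apath_def)
  then obtain r where "closed_w r"
    using awalk_cyc_decompE'[OF p(1)] by metis
  then show ?thesis by (rule closed_w_imp_cycle)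
qed


section \<open>Costs and balances\<close>

lemma net_outflow_arcs:
  assumes "finite A"
  shows "net_outflow A f i = (\<Sum>a | a \<in> A \<and> fst a = i. f a) - (\<Sum>a | a \<in> A \<and> snd a = i. f a)"
proof -
  have "{a. a \<in> A \<and> fst a = i} = Pair i ` {j. (i, j) \<in> A}"
    "{a. a \<in> A \<and> snd a = i} = (\<lambda>j. (j, i)) ` {j. (j, i) \<in> A}"
    by (auto simp: image_iff)
  then show ?thesis
    unfolding net_outflow_def by (simp add: sum.reindex inj_on_def)
qed

lemma net_outflow_Diff:
  assumes "finite A" "X \<subseteq> A"
  shows "net_outflow (A - X) f i = net_outflow A f i - net_outflow X f i"
proof -
  have split: "(\<Sum>a | a \<in> A \<and> P a. f a) = (\<Sum>a | a \<in> A - X \<and> P a. f a) + (\<Sum>a | a \<in> X \<and> P a. f a)" for P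
  proof -
    have "{a. a \<in> A \<and> P a} = {a. a \<in> A - X \<and> P a} \<union> {a. a \<in> X \<and> P a}"
      using assms by auto
    then show ?thesis
      using assms finite_subset[OF assms(2)] by (simp only:) (rule sum.union_disjoint; auto)
  qed
  show ?thesis
    using assms finite_subset[OF assms(2)] split[of "\<lambda>a. fst a = i"] split[of "\<lambda>a. snd a = i"]
    by (simp add: net_outflow_arcs)
qed

lemma net_outflow_add: "net_outflow A (\<lambda>a. f a + g a) i = net_outflow A f i + net_outflow A g i"
  by (simp add: net_outflow_def sum.distrib)

lemma net_outflow_diff: "net_outflow A (\<lambda>a. f a - g a) i = net_outflow A f i - net_outflow A g i"
  by (simp add: net_outflow_def sum_subtractf)

lemma net_outflow_cong:
  "(\<And>a. a \<in> A \<Longrightarrow> f a = g a) \<Longrightarrow> net_outflow A f i = net_outflow A g i"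
  by (simp add: net_outflow_def)

lemma flow_cost_add: "flow_cost N c (\<lambda>a. f a + g a) = flow_cost N c f + flow_cost N c g"
  by (simp add: flow_cost_def algebra_simps sum.distrib)

lemma flow_cost_diff: "flow_cost N c (\<lambda>a. f a - g a) = flow_cost N c f - flow_cost N c g"
  by (simp add: flow_cost_def algebra_simps sum_subtractf)

lemma flow_cost_weighted:
  "flow_cost N (weighted_cost w c1 c2) f = fst w * flow_cost N c1 f + snd w * flow_cost N c2 f"
  by (simp add: flow_cost_def weighted_cost_def algebra_simps sum.distrib sum_distrib_left)

text \<open>Summation by parts: grouping the potential terms by tail and by head leaves only the net
  outflows. Flows with equal balances are therefore shifted by the same constant.\<close>

lemma flow_cost_reduced_cost:
  assumes "pair_fin_digraph (net_graph N)"
  shows "flow_cost N (reduced_cost c y) f =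
    flow_cost N c f + (\<Sum>i\<in>pverts (net_graph N). y i * of_int (net_outflow (net_arcs N) f i))"
proof -
  interpret pair_fin_digraph "net_graph N" by fact
  let ?V = "pverts (net_graph N)" and ?A = "net_arcs N"
  have group: "(\<Sum>a\<in>?A. y (k a) * f a) = (\<Sum>i\<in>?V. y i * of_int (\<Sum>a | a \<in> ?A \<and> k a = i. f a))"
    if "k ` ?A \<subseteq> ?V" for k
  proof -
    have "(\<Sum>a\<in>?A. y (k a) * f a) = (\<Sum>i\<in>?V. \<Sum>a | a \<in> ?A \<and> k a = i. y (k a) * f a)"
      using that by (intro sum.group[symmetric]) auto
    also have "\<dots> = (\<Sum>i\<in>?V. y i * of_int (\<Sum>a | a \<in> ?A \<and> k a = i. f a))"
      by (intro sum.cong refl) (simp add: sum_distrib_left)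
    finally show ?thesis .
  qed
  have "fst ` ?A \<subseteq> ?V" "snd ` ?A \<subseteq> ?V"
    by (auto intro: in_arcsD1 in_arcsD2)
  note g = group[OF this(1)] group[OF this(2)]
  have "flow_cost N (reduced_cost c y) f =
    flow_cost N c f + (\<Sum>a\<in>?A. y (fst a) * f a) - (\<Sum>a\<in>?A. y (snd a) * f a)"
    by (simp add: flow_cost_def reduced_cost_def algebra_simps sum.distrib sum_subtractf)
  also have "\<dots> = flow_cost N c f + (\<Sum>i\<in>?V. y i * of_int (net_outflow ?A f i))"
    unfolding g by (simp add: net_outflow_arcs algebra_simps sum_subtractf)
  finally show ?thesis .
qed

text \<open>The indicator potential of \<open>i\<close> turns a balance into a cost, so that
  conservation along a cycle follows from a cost computation.\<close>

lemma net_outflow_eq_flow_cost: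
  assumes "pair_fin_digraph (net_graph N)" "i \<in> pverts (net_graph N)"
  shows "of_int (net_outflow (net_arcs N) f i) =
    flow_cost N (reduced_cost (\<lambda>_. 0) (\<lambda>j. if j = i then 1 else 0)) f"
proof -
  interpret pair_fin_digraph "net_graph N" by fact
  have "(\<Sum>j\<in>pverts (net_graph N). (if j = i then 1 else 0) * real_of_int (net_outflow (net_arcs N) f j))
    = (\<Sum>j\<in>pverts (net_graph N). if j = i then real_of_int (net_outflow (net_arcs N) f i) else 0)"
    by (intro sum.cong) auto
  then show ?thesis
    unfolding flow_cost_reduced_cost[OF assms(1)] using assms(2) by (simp add: flow_cost_def)
qed


section \<open>Residual cycles\<close>

lemma residual_network_simps [simp]:
  "verts (residual_network N f) = pverts (net_graph N)"
  "arcs (residual_network N f) =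
    {Forward a | a. a \<in> net_arcs N \<and> f a < upper_cap N a}
    \<union> {Backward a | a. a \<in> net_arcs N \<and> lower_cap N a < f a}"
  "tail (residual_network N f) = residual_tail"
  "head (residual_network N f) = residual_head"
  by (simp_all add: residual_network_def)

lemma fin_digraph_residual_network:
  assumes "pair_fin_digraph (net_graph N)"
  shows "fin_digraph (residual_network N f)"
proof -
  interpret pair_fin_digraph "net_graph N" by fact
  have "arcs (residual_network N f) \<subseteq> Forward ` net_arcs N \<union> Backward ` net_arcs N"
    by auto
  then have "finite (arcs (residual_network N f))"
    by (rule finite_subset) simp
  then show ?thesis
    by unfold_locales (auto intro: in_arcsD1 in_arcsD2)
qed

lemma residual_cycle_distinct:
  assumes "pair_fin_digraph (net_graph N)" "residual_cycle N f C"
  shows "distinct C"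
proof -
  interpret fin_digraph "residual_network N f" by (rule fin_digraph_residual_network) fact
  show ?thesis using assms(2) by (auto simp: residual_cycle_def cycle_conv)
qed

lemma residual_cycle_arcs:
  assumes "residual_cycle N f C"
  shows "set C \<subseteq> arcs (residual_network N f)"
  using assms by (auto simp: residual_cycle_def pre_digraph.cycle_def pre_digraph.awalk_def)

lemma residual_cost_potential:
  "residual_cost (reduced_cost (\<lambda>_. 0) y) r = y (residual_tail r) - y (residual_head r)"
  by (cases r) (auto simp: reduced_cost_def)

text \<open>Costs derived from a potential telescope along a walk; the induction is over walks with
  arbitrary ends.\<close>

lemma cycle_cost_potential:
  assumes "residual_cycle N f C"
  shows "cycle_cost (reduced_cost (\<lambda>_. 0) y) C = 0"
proof -
  interpret pre_digraph "residual_network N f" .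
  have "cas u p v \<Longrightarrow> cycle_cost (reduced_cost (\<lambda>_. 0) y) p = y u - y v" for u p v
    by (induction p arbitrary: u) (auto simp: cycle_cost_def residual_cost_potential)
  then show ?thesis
    using assms by (auto simp: residual_cycle_def cycle_def awalk_def)
qed

lemma flow_cost_cycle_flow:
  assumes fin: "pair_fin_digraph (net_graph N)" and C: "residual_cycle N f C"
  shows "flow_cost N c (cycle_flow C) = cycle_cost c C"
proof -
  interpret pair_fin_digraph "net_graph N" by fact
  let ?F = "{a \<in> net_arcs N. Forward a \<in> set C}" and ?B = "{a \<in> net_arcs N. Backward a \<in> set C}"
  have set_C: "set C = Forward ` ?F \<union> Backward ` ?B"
    using residual_cycle_arcs[OF C] by auto
  have "cycle_cost c C = (\<Sum>r\<in>set C. residual_cost c r)"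
    using residual_cycle_distinct[OF fin C] by (simp add: cycle_cost_def sum_list_distinct_conv_sum_set)
  also have "\<dots> = (\<Sum>r\<in>Forward ` ?F. residual_cost c r) + (\<Sum>r\<in>Backward ` ?B. residual_cost c r)"
    by (subst set_C, rule sum.union_disjoint) auto
  also have "\<dots> = (\<Sum>a\<in>?F. c a) - (\<Sum>a\<in>?B. c a)"
    by (simp add: sum.reindex inj_on_def sum_negf)
  also have "\<dots> = (\<Sum>a\<in>net_arcs N. (if Forward a \<in> set C then c a else 0) - (if Backward a \<in> set C then c a else 0))"
    by (simp add: sum_subtractf sum.inter_filter)
  \<comment> \<open>The two indicators combine to \<open>cycle_flow\<close> because a residual cycle
    never uses both copies of an arc.\<close>
  also have "\<dots> = flow_cost N c (cycle_flow C)"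
    unfolding flow_cost_def using C
    by (intro sum.cong refl) (auto simp: cycle_flow_def residual_cycle_def)
  finally show ?thesis by simp
qed

lemma net_outflow_cycle_flow:
  assumes "pair_fin_digraph (net_graph N)" "residual_cycle N f C" "i \<in> pverts (net_graph N)"
  shows "net_outflow (net_arcs N) (cycle_flow C) i = 0"
proof -
  have "real_of_int (net_outflow (net_arcs N) (cycle_flow C) i) = 0"
    unfolding net_outflow_eq_flow_cost[OF assms(1,3)] flow_cost_cycle_flow[OF assms(1,2)]
    by (rule cycle_cost_potential[OF assms(2)])
  then show ?thesis by simp
qed

text \<open>By integrality, a strict capacity inequality leaves room for the one unit that a cycle
  moves on an arc.\<close>

lemma feasible_flow_add_cycle_flow:
  assumes "pair_fin_digraph (net_graph N)" "feasible_flow N f" "residual_cycle N f C"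
  shows "feasible_flow N (\<lambda>a. f a + cycle_flow C a)"
proof -
  have "lower_cap N a \<le> f a + cycle_flow C a \<and> f a + cycle_flow C a \<le> upper_cap N a"
    if "a \<in> net_arcs N" for a
  proof -
    have "lower_cap N a \<le> f a" "f a \<le> upper_cap N a"
      using assms(2) that by (auto simp: feasible_flow_def)
    moreover have "Forward a \<in> set C \<Longrightarrow> f a < upper_cap N a" "Backward a \<in> set C \<Longrightarrow> lower_cap N a < f a"
      using residual_cycle_arcs[OF assms(3)] by auto
    ultimately show ?thesis by (auto simp: cycle_flow_def)
  qed
  then show ?thesis
    using assms by (auto simp: feasible_flow_def net_outflow_add net_outflow_cycle_flow)
qed


section \<open>Cycles between two feasible flows\<close>

text \<open>The residual arcs in the direction of the difference of two feasible flows form a subgraph in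
  which every arc can be continued, by flow conservation at its head; so this subgraph has a cycle.\<close>

lemma ex_conformal_cycle:
  assumes fin: "pair_fin_digraph (net_graph N)"
    and f: "feasible_flow N f" and g: "feasible_flow N g"
    and a0: "a0 \<in> net_arcs N" "f a0 \<noteq> g a0"
  shows "\<exists>Z. residual_cycle N f Z \<and>
    (\<forall>a. Forward a \<in> set Z \<longrightarrow> f a < g a) \<and> (\<forall>a. Backward a \<in> set Z \<longrightarrow> g a < f a)"
proof -
  interpret pair_fin_digraph "net_graph N" by fact
  let ?A = "net_arcs N" and ?R = "residual_network N f"
  interpret R: fin_digraph ?R by (rule fin_digraph_residual_network) fact
  define S where "S = {Forward a | a. a \<in> ?A \<and> f a < g a} \<union> {Backward a | a. a \<in> ?A \<and> g a < f a}"
  define H where "H = ?R\<lparr>arcs := S\<rparr>"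
  have H: "verts H = pverts (net_graph N)" "arcs H = S" "tail H = residual_tail" "head H = residual_head"
    by (simp_all add: H_def residual_network_def)
  \<comment> \<open>Since \<open>g\<close> respects the capacities, a strict difference between
    \<open>f\<close> and \<open>g\<close> means slack in the direction of \<open>g\<close>.\<close>
  have S_sub: "S \<subseteq> arcs ?R"
    using f g by (force simp: S_def feasible_flow_def)
  have "finite S" using S_sub R.finite_arcs by (rule finite_subset)
  then interpret H: fin_digraph H
    by unfold_locales (auto simp: H S_def intro: in_arcsD1 in_arcsD2)
  have continue: "\<exists>e'\<in>S. residual_tail e' = residual_head e" if "e \<in> S" for e
  proof (rule ccontr)
    assume no: "\<not> ?thesis"
    define v where "v = residual_head e"
    define h where "h a = g a - f a" for a
    let ?out = "{a. a \<in> ?A \<and> fst a = v}" and ?in = "{a. a \<in> ?A \<and> snd a = v}"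
    \<comment> \<open>As no arc of \<open>S\<close> leaves \<open>v\<close>, \<open>h\<close> has
      one sign on outgoing arcs and the opposite sign on incoming ones; zero net outflow then makes
      every term vanish.\<close>
    have out: "h a \<le> 0" if "a \<in> ?out" for a
    proof (rule ccontr)
      assume "\<not> h a \<le> 0"
      then have "Forward a \<in> S" using that by (cases a) (auto simp: S_def h_def)
      then show False using no that by (force simp: v_def)
    qed
    have incoming: "0 \<le> h a" if "a \<in> ?in" for a
    proof (rule ccontr)
      assume "\<not> 0 \<le> h a"
      then have "Backward a \<in> S" using that by (cases a) (auto simp: S_def h_def)
      then show False using no that by (force simp: v_def)
    qed
    have "v \<in> pverts (net_graph N)"
      using H.head_in_verts[of e] that by (simp add: H v_def)
    then have "net_outflow ?A h v = 0"
      using f g unfolding h_def by (simp add: net_outflow_diff feasible_flow_def)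
    then have "sum h ?out - sum h ?in = 0" by (simp add: net_outflow_arcs)
    moreover have "sum h ?out \<le> 0" "0 \<le> sum h ?in"
      using out incoming by (auto intro!: sum_nonpos sum_nonneg)
    ultimately have "sum h ?out = 0" "sum h ?in = 0" by linarith+
    then have zero: "h a = 0" if "a \<in> ?out \<union> ?in" for a
      using that out incoming sum_nonneg_eq_0_iff[of ?in h] sum_nonneg_eq_0_iff[of ?out "\<lambda>a. - h a"]
      by (cases a) (auto simp: sum_negf)
    \<comment> \<open>The arc underlying \<open>e\<close> is incident to \<open>v\<close> but has a
      nonzero difference.\<close>
    from that obtain a where "a \<in> ?A" "e = Forward a \<and> f a < g a \<or> e = Backward a \<and> g a < f a"
      by (auto simp: S_def)
    then show False
      using zero[of a] by (auto simp: v_def h_def)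
  qed
  have "Forward a0 \<in> S \<or> Backward a0 \<in> S" using a0 by (cases a0) (auto simp: S_def)
  then obtain Z where Z: "H.cycle Z"
    using H.ex_cycle_if_arcs_continue continue unfolding H by blast
  have "subgraph H ?R"
    using S_sub by (intro subgraphI) (auto simp: H compatible_def R.wf_digraph H.wf_digraph)
  then have "R.cycle Z" using Z by (rule R.subgraph_cycle)
  moreover have "set Z \<subseteq> S"
    using Z by (auto simp: H.cycle_def H.awalk_def H)
  then have "(\<forall>a. Forward a \<in> set Z \<longrightarrow> f a < g a) \<and> (\<forall>a. Backward a \<in> set Z \<longrightarrow> g a < f a)"
    by (auto simp: S_def)
  ultimately show ?thesis
    unfolding residual_cycle_def by (metis less_asym)
qed

text \<open>On each arc of \<open>Z\<close>, \<open>g\<close> moves one unit towards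
  \<open>f\<close> and, by integrality, not past it, so it stays within the capacities.\<close>

lemma feasible_flow_diff_conformal_cycle:
  assumes "pair_fin_digraph (net_graph N)" "feasible_flow N f" "feasible_flow N g"
    and "residual_cycle N f Z"
    and "\<And>a. Forward a \<in> set Z \<Longrightarrow> f a < g a" "\<And>a. Backward a \<in> set Z \<Longrightarrow> g a < f a"
  shows "feasible_flow N (\<lambda>a. g a - cycle_flow Z a)"
proof -
  have "lower_cap N a \<le> g a - cycle_flow Z a \<and> g a - cycle_flow Z a \<le> upper_cap N a"
    if "a \<in> net_arcs N" for a
  proof -
    have "lower_cap N a \<le> f a" "f a \<le> upper_cap N a" "lower_cap N a \<le> g a" "g a \<le> upper_cap N a"
      using assms(2,3) that by (auto simp: feasible_flow_def)
    then show ?thesis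
      using assms(5,6)[of a] by (auto simp: cycle_flow_def)
  qed
  then show ?thesis
    using assms by (auto simp: feasible_flow_def net_outflow_diff net_outflow_cycle_flow)
qed

text \<open>Instead of decomposing \<open>g - f\<close> completely, peel off conformal cycles of cost zero until one of
  positive cost appears: what remains then still costs at least as much as \<open>f\<close>.\<close>

lemma ex_cheap_positive_cycle:
  assumes fin: "pair_fin_digraph (net_graph N)" and opt: "optimal_flow N c f"
    and "feasible_flow N g" "flow_cost N c f < flow_cost N c g"
  shows "\<exists>Z. residual_cycle N f Z \<and> 0 < cycle_cost c Z \<and>
    cycle_cost c Z \<le> flow_cost N c g - flow_cost N c f"
  using assms(3,4)
\<comment> \<open>The induction is on the total distance of \<open>g\<close> from
  \<open>f\<close>.\<close>
proof (induction "\<Sum>a\<in>net_arcs N. nat \<bar>g a - f a\<bar>" arbitrary: g rule: less_induct)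
  case less
  interpret pair_fin_digraph "net_graph N" by fact
  have least: "flow_cost N c f \<le> flow_cost N c h" if "feasible_flow N h" for h
    using opt that by (auto simp: optimal_flow_def is_arg_min_linorder)
  have f: "feasible_flow N f" using opt by (simp add: optimal_flow_def is_arg_min_def)
  have "\<exists>a\<in>net_arcs N. f a \<noteq> g a"
  proof (rule ccontr)
    assume "\<not> ?thesis"
    then have "flow_cost N c f = flow_cost N c g" by (simp add: flow_cost_def)
    then show False using less.prems by simp
  qed
  then obtain Z where Z: "residual_cycle N f Z"
    and fwd: "\<And>a. Forward a \<in> set Z \<Longrightarrow> f a < g a" and bwd: "\<And>a. Backward a \<in> set Z \<Longrightarrow> g a < f a"
    using ex_conformal_cycle[OF fin f less.prems(1)] by blast
  define h where "h a = g a - cycle_flow Z a" for a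
  have h: "feasible_flow N h"
    unfolding h_def using fin f less.prems(1) Z fwd bwd by (rule feasible_flow_diff_conformal_cycle)
  have cost_h: "flow_cost N c h = flow_cost N c g - cycle_cost c Z"
    unfolding h_def by (simp add: flow_cost_diff flow_cost_cycle_flow[OF fin Z])
  have "flow_cost N c f \<le> flow_cost N c (\<lambda>a. f a + cycle_flow Z a)"
    by (intro least feasible_flow_add_cycle_flow fin f Z)
  then have nonneg: "0 \<le> cycle_cost c Z"
    by (simp add: flow_cost_add flow_cost_cycle_flow[OF fin Z])
  show ?case
  proof (cases "cycle_cost c Z = 0")
    case False
    \<comment> \<open>Here \<open>h\<close> costs at least as much as \<open>f\<close>, which bounds
      the cost of \<open>Z\<close> by the gap between \<open>g\<close> and \<open>f\<close>.\<close>
    then show ?thesis using nonneg Z least[OF h] cost_h by force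
  next
    case True
    \<comment> \<open>A cycle is nonempty, so the distance to \<open>f\<close> drops strictly on
      some arc while the cost of \<open>g\<close> is kept.\<close>
    obtain r where r: "r \<in> set Z"
      using Z by (cases Z) (auto simp: residual_cycle_def pre_digraph.cycle_def)
    then obtain a where a: "a \<in> net_arcs N" "r = Forward a \<or> r = Backward a"
      using residual_cycle_arcs[OF Z] by auto
    have le: "nat \<bar>h b - f b\<bar> \<le> nat \<bar>g b - f b\<bar>" for b
      using fwd[of b] bwd[of b] by (auto simp: h_def cycle_flow_def)
    have "nat \<bar>h a - f a\<bar> < nat \<bar>g a - f a\<bar>"
      using fwd[of a] bwd[of a] a r by (auto simp: h_def cycle_flow_def)
    then have "(\<Sum>a\<in>net_arcs N. nat \<bar>h a - f a\<bar>) < (\<Sum>a\<in>net_arcs N. nat \<bar>g a - f a\<bar>)"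
      using a(1) le by (intro sum_strict_mono_ex1) auto
    then show ?thesis
      using less.hyps[of h] h less.prems cost_h True by simp
  qed
qed

text \<open>The gap between \<open>f\<close> and \<open>g\<close> is at least the cost of some
  positive residual cycle, hence at least that of the cheapest one.\<close>

lemma min_positive_cycle_cost_le:
  assumes fin: "pair_fin_digraph (net_graph N)" and opt: "optimal_flow N c f"
    and C: "is_arg_min (cycle_cost c) (\<lambda>Z. residual_cycle N f Z \<and> 0 < cycle_cost c Z) C"
    and g: "feasible_flow N g" "flow_cost N c f < flow_cost N c g"
  shows "flow_cost N c (\<lambda>a. f a + cycle_flow C a) \<le> flow_cost N c g"
proof -
  have "residual_cycle N f C"
    and least: "cycle_cost c C \<le> cycle_cost c Z" if "residual_cycle N f Z" "0 < cycle_cost c Z" for Z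
    using C that by (auto simp: is_arg_min_linorder)
  moreover obtain Z where "residual_cycle N f Z" "0 < cycle_cost c Z"
    "cycle_cost c Z \<le> flow_cost N c g - flow_cost N c f"
    using ex_cheap_positive_cycle[OF fin opt g] by blast
  ultimately show ?thesis
    by (force simp: flow_cost_add flow_cost_cycle_flow[OF fin])
qed


section \<open>The reduced network\<close>

lemma reduced_network_simps [simp]:
  "net_arcs (reduced_network N rc f0) = net_arcs N - fixed_arcs N rc"
  "pverts (net_graph (reduced_network N rc f0)) = pverts (net_graph N)"
  "lower_cap (reduced_network N rc f0) = lower_cap N"
  "upper_cap (reduced_network N rc f0) = upper_cap N"
  "balance (reduced_network N rc f0) = (\<lambda>i. balance N i - net_outflow (fixed_arcs N rc) f0 i)"
  by (simp_all add: reduced_network_def)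

lemma pair_fin_digraph_reduced_network:
  assumes "pair_fin_digraph (net_graph N)"
  shows "pair_fin_digraph (net_graph (reduced_network N rc f0))"
proof -
  interpret pair_fin_digraph "net_graph N" by fact
  show ?thesis by unfold_locales (auto intro: in_arcsD1 in_arcsD2)
qed

text \<open>The fixed arcs contribute a constant, so cost comparisons agree in both
  networks.\<close>

lemma flow_cost_extend_flow:
  assumes "pair_fin_digraph (net_graph N)"
  shows "flow_cost N c (extend_flow (fixed_arcs N rc) f0 f) =
    flow_cost (reduced_network N rc f0) c f + (\<Sum>a\<in>fixed_arcs N rc. c a * f0 a)"
proof -
  interpret pair_fin_digraph "net_graph N" by fact
  have "fixed_arcs N rc \<subseteq> net_arcs N" by (auto simp: fixed_arcs_def)
  then have "flow_cost N c (extend_flow (fixed_arcs N rc) f0 f) =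
    (\<Sum>a\<in>net_arcs N - fixed_arcs N rc. c a * extend_flow (fixed_arcs N rc) f0 f a) +
    (\<Sum>a\<in>fixed_arcs N rc. c a * extend_flow (fixed_arcs N rc) f0 f a)"
    unfolding flow_cost_def by (intro sum.subset_diff) auto
  then show ?thesis
    by (simp add: flow_cost_def extend_flow_def)
qed

lemma feasible_flow_reduced_network:
  assumes "pair_fin_digraph (net_graph N)" "feasible_flow N g"
    and "\<And>a. a \<in> fixed_arcs N rc \<Longrightarrow> g a = f0 a"
  shows "feasible_flow (reduced_network N rc f0) g"
proof -
  interpret pair_fin_digraph "net_graph N" by fact
  have "fixed_arcs N rc \<subseteq> net_arcs N" by (auto simp: fixed_arcs_def)
  moreover have "net_outflow (fixed_arcs N rc) g i = net_outflow (fixed_arcs N rc) f0 i" for i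
    using assms(3) by (rule net_outflow_cong)
  ultimately show ?thesis
    using assms(2) by (auto simp: feasible_flow_def net_outflow_Diff)
qed

text \<open>The difference of the costs of \<open>g\<close> and \<open>f0\<close> is a sum of products of reduced costs and flow
  differences, each of which is nonnegative by complementary slackness.\<close>

lemma fixed_arcs_eq_of_cost_le:
  assumes fin: "pair_fin_digraph (net_graph N)"
    and f0: "feasible_flow N f0" and g: "feasible_flow N g"
    and rc: "rc = reduced_cost c y" and cs: "complementary_slackness N rc f0"
    and le: "flow_cost N c g \<le> flow_cost N c f0"
    and a: "a \<in> fixed_arcs N rc"
  shows "g a = f0 a"
proof -
  interpret pair_fin_digraph "net_graph N" by fact
  \<comment> \<open>Equal balances make the potential terms cancel, so \<open>le\<close> carries
    over to reduced costs.\<close>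
  have "(\<Sum>i\<in>pverts (net_graph N). y i * net_outflow (net_arcs N) g i) =
    (\<Sum>i\<in>pverts (net_graph N). y i * net_outflow (net_arcs N) f0 i)"
    using f0 g by (simp add: feasible_flow_def)
  then have "flow_cost N rc (\<lambda>a. g a - f0 a) \<le> 0"
    using le by (simp add: rc flow_cost_diff flow_cost_reduced_cost[OF fin])
  then have sum_le: "(\<Sum>b\<in>net_arcs N. rc b * real_of_int (g b - f0 b)) \<le> 0"
    by (simp add: flow_cost_def)
  have nonneg: "0 \<le> rc b * real_of_int (g b - f0 b)" if "b \<in> net_arcs N" for b
  proof -
    have "lower_cap N b \<le> g b" "g b \<le> upper_cap N b" using g that by (auto simp: feasible_flow_def)
    moreover have "0 < rc b \<Longrightarrow> f0 b = lower_cap N b" "rc b < 0 \<Longrightarrow> f0 b = upper_cap N b"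
      using cs that unfolding complementary_slackness_def by blast+
    ultimately show ?thesis
      unfolding zero_le_mult_iff by (metis diff_ge_0_iff_ge diff_le_0_iff_le linorder_le_cases not_le of_int_0_le_iff of_int_le_0_iff)
  qed
  have "(\<Sum>b\<in>net_arcs N. rc b * real_of_int (g b - f0 b)) = 0"
    using sum_le nonneg by (intro antisym sum_nonneg) auto
  then have "\<forall>b\<in>net_arcs N. rc b * real_of_int (g b - f0 b) = 0"
    using nonneg by (subst (asm) sum_nonneg_eq_0_iff) auto
  then show ?thesis using a by (auto simp: fixed_arcs_def)
qed


section \<open>Edges of the upper image\<close>

lemma upper_imageI:
  "r \<in> convex hull Y \<Longrightarrow> fst r \<le> fst x \<Longrightarrow> snd r \<le> snd x \<Longrightarrow> x \<in> upper_image Y"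
  unfolding upper_image_def by (rule CollectI) (rule exI[of _ r], rule exI[of _ "x - r"], auto)

text \<open>A point \<open>z\<close> below the line through \<open>p\<close> and \<open>q\<close> could be joined through the midpoint \<open>m\<close> of the
  edge to a point \<open>b\<close> of the upper image above the line, against the face property.\<close>

lemma edge_minimizes_weighted_sum:
  assumes edge: "closed_segment p q edge_of upper_image Y"
    and Y: "p \<in> Y" "q \<in> Y" "z \<in> Y"
    and less: "fst p < fst q" "snd q < snd p"
  shows "(snd p - snd q) * fst p + (fst q - fst p) * snd p
    \<le> (snd p - snd q) * fst z + (fst q - fst p) * snd z"
proof (rule ccontr)
  define k l where "k = snd p - snd q" and "l = fst q - fst p"
  have kl: "0 < k" "0 < l" using less by (auto simp: k_def l_def)
  assume "\<not> ?thesis"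
  then have below: "k * fst z + l * snd z < k * fst p + l * snd p" by (simp add: k_def l_def)
  define m where "m = (1/2) *\<^sub>R p + (1/2) *\<^sub>R q"
  define d where "d = m - z"
  \<comment> \<open>\<open>r\<close> and \<open>s\<close> are the coordinates of \<open>d\<close> in
    the basis \<open>(1, 1)\<close> and \<open>q - p = (l, -k)\<close>.\<close>
  define r where "r = (k * fst d + l * snd d) / (k + l)"
  define s where "s = (fst d - r) / l"
  \<comment> \<open>\<open>e\<close> is so small that moving from the midpoint by
    \<open>e * s\<close> along \<open>q - p\<close> stays on the segment.\<close>
  define e where "e = 1 / (2 * (1 + \<bar>s\<bar>))"
  define b where "b = m + e *\<^sub>R d"
  have line: "k * fst m + l * snd m = k * fst p + l * snd p"
    by (simp add: m_def k_def l_def field_simps)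
  have r: "0 < r" unfolding r_def using kl below line by (simp add: d_def algebra_simps)
  have e: "0 < e" "\<bar>e * s\<bar> \<le> 1/2" by (simp_all add: e_def abs_mult field_simps)
  have d1: "fst d = s * l + r" using kl by (simp add: s_def)
  have "l * snd d = r * (k + l) - k * fst d" using kl by (simp add: r_def)
  also have "\<dots> = l * (r - s * k)" unfolding d1 by (simp add: algebra_simps)
  finally have d2: "snd d = r - s * k" using kl by simp
  \<comment> \<open>\<open>t\<close> is \<open>b\<close> without its \<open>(1, 1)\<close> component
    \<open>e * r\<close>, so \<open>b\<close> lies above a point of the segment.\<close>
  define t where "t = (1/2 - e * s) *\<^sub>R p + (1/2 + e * s) *\<^sub>R q"
  have t_seg: "t \<in> closed_segment p q"
    using e unfolding t_def closed_segment_def by (intro CollectI exI[of _ "1/2 + e * s"]) auto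
  have seg_hull: "closed_segment p q \<subseteq> convex hull Y"
    using Y by (intro closed_segment_subset) (auto intro: hull_inc)
  have "fst b = fst t + e * r" "snd b = snd t + e * r"
    unfolding b_def by (simp_all add: d1 d2 t_def m_def k_def l_def algebra_simps)
  then have b: "b \<in> upper_image Y"
    using t_seg seg_hull e r by (intro upper_imageI[of t]) auto
  have z: "z \<in> upper_image Y" using Y by (intro upper_imageI[of z]) (auto intro: hull_inc)
  have "d \<noteq> 0" using r by (auto simp: r_def)
  have bz: "b - z = (1 + e) *\<^sub>R d" by (simp add: b_def d_def algebra_simps)
  have "z \<noteq> b" using bz \<open>d \<noteq> 0\<close> e by auto
  \<comment> \<open>The parameter comes from \<open>m = z + d\<close> and
    \<open>b = z + (1 + e) d\<close>.\<close>
  moreover have "m = (1 - 1 / (1 + e)) *\<^sub>R z + (1 / (1 + e)) *\<^sub>R b"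
  proof -
    have "(1 - 1 / (1 + e)) *\<^sub>R z + (1 / (1 + e)) *\<^sub>R b = z + (1 / (1 + e)) *\<^sub>R (b - z)"
      by (simp add: algebra_simps)
    also have "\<dots> = z + d" unfolding bz using e by simp
    finally show ?thesis by (simp add: d_def)
  qed
  ultimately have "m \<in> open_segment z b"
    using e unfolding in_segment by (intro conjI exI[of _ "1 / (1 + e)"]) auto
  moreover have "m \<in> closed_segment p q"
    unfolding m_def closed_segment_def by (intro CollectI exI[of _ "1/2"]) auto
  ultimately have "z \<in> closed_segment p q"
    using edge z b unfolding edge_of_def face_of_def by blast
  then obtain u where "z = (1 - u) *\<^sub>R p + u *\<^sub>R q" by (auto simp: closed_segment_def)
  then have "fst z = (1 - u) * fst p + u * fst q" "snd z = (1 - u) * snd p + u * snd q" by simp_all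
  then have "k * fst z + l * snd z = k * fst p + l * snd p"
    unfolding k_def l_def by algebra
  then show False using below by simp
qed

theorem theorem4p7:
  fixes N :: "'a network"
    and c1 c2 :: "'a cost"
    and p q lam :: "real \<times> real"
    and f0 :: "'a flow"
    and y :: "'a \<Rightarrow> real"
    and rc :: "'a cost"
    and N' :: "'a network"
    and f' f'' :: "'a flow"
    and C :: "'a residual_arc list"
  assumes "flow_network N"
    and "consecutive_extreme_supported (image_set N c1 c2) p q"
    and "fst p < fst q"
    and "lam = (snd p - snd q, fst q - fst p)"
    and "optimal_flow N (weighted_cost lam c1 c2) f0"
    and "rc = reduced_cost (weighted_cost lam c1 c2) y"
    and "complementary_slackness N rc f0"
    and "N' = reduced_network N rc f0"
    and "optimal_flow N' c1 f'"
    and "is_arg_min (cycle_cost c1) (\<lambda>Z. residual_cycle N' f' Z \<and> 0 < cycle_cost c1 Z) C"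
    and "f'' = (\<lambda>a. f' a + cycle_flow C a)"
  shows "(\<nexists>g. feasible_flow N' g \<and>
              flow_cost N' c1 f' < flow_cost N' c1 g \<and> flow_cost N' c1 g < flow_cost N' c1 f'')
       \<and> (\<nexists>g. feasible_flow N g \<and> flow_image N c1 c2 g \<in> closed_segment p q \<and>
              flow_cost N c1 (extend_flow (fixed_arcs N rc) f0 f') < flow_cost N c1 g \<and>
              flow_cost N c1 g < flow_cost N c1 (extend_flow (fixed_arcs N rc) f0 f''))"
proof -
  have fin: "pair_fin_digraph (net_graph N)" using assms(1) by (simp add: flow_network_def)
  have fin': "pair_fin_digraph (net_graph N')"
    unfolding assms(8) using fin by (rule pair_fin_digraph_reduced_network)
  note between = min_positive_cycle_cost_le[OF fin' assms(9,10), folded assms(11)]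
  have f0: "feasible_flow N f0" using assms(5) by (simp add: optimal_flow_def is_arg_min_def)
  have pq: "p \<in> image_set N c1 c2" "q \<in> image_set N c1 c2"
    and edge: "closed_segment p q edge_of upper_image (image_set N c1 c2)"
    and nd: "nondominated (image_set N c1 c2) q"
    using assms(2) by (auto simp: consecutive_extreme_supported_def
        extreme_supported_nondominated_def nondominated_def)
  \<comment> \<open>Otherwise \<open>p\<close>, being to the left of \<open>q\<close>, would
    dominate it.\<close>
  have snd_less: "snd q < snd p"
    using nd pq(1) assms(3) unfolding nondominated_def by (metis less_eq_real_def less_irrefl not_le)
  have lower_cost: "flow_cost N' c1 g = flow_cost N c1 g - (\<Sum>a\<in>fixed_arcs N rc. c1 a * f0 a)
      \<and> feasible_flow N' g"
    if g: "feasible_flow N g" "flow_image N c1 c2 g \<in> closed_segment p q" for g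
  proof -
    have "flow_image N c1 c2 f0 \<in> image_set N c1 c2" using f0 by (auto simp: image_set_def)
    from edge_minimizes_weighted_sum[OF edge pq this assms(3) snd_less]
    have min: "fst lam * fst p + snd lam * snd p \<le> flow_cost N (weighted_cost lam c1 c2) f0"
      by (simp add: assms(4) flow_cost_weighted flow_image_def)
    obtain u where "flow_image N c1 c2 g = (1 - u) *\<^sub>R p + u *\<^sub>R q"
      using g(2) by (auto simp: closed_segment_def)
    then have "flow_cost N c1 g = (1 - u) * fst p + u * fst q"
      "flow_cost N c2 g = (1 - u) * snd p + u * snd q"
      by (auto simp: flow_image_def prod_eq_iff)
    \<comment> \<open>\<open>lam\<close> is orthogonal to \<open>q - p\<close>, so the weighted cost
      is constant on the segment; by \<open>min\<close> it does not exceed that of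
      \<open>f0\<close>.\<close>
    then have "flow_cost N (weighted_cost lam c1 c2) g = fst lam * fst p + snd lam * snd p"
      unfolding flow_cost_weighted assms(4) fst_conv snd_conv by algebra
    with min have eq: "g a = f0 a" if "a \<in> fixed_arcs N rc" for a
      using fixed_arcs_eq_of_cost_le[OF fin f0 g(1) assms(6,7) _ that] by simp
    then have "extend_flow (fixed_arcs N rc) f0 g = g" by (auto simp: extend_flow_def)
    then show ?thesis
      using flow_cost_extend_flow[OF fin, of c1 rc f0 g] feasible_flow_reduced_network[OF fin g(1) eq]
      by (simp add: assms(8))
  qed
  show ?thesis
  proof (intro conjI notI; elim exE conjE)
    fix g assume "feasible_flow N' g" "flow_cost N' c1 f' < flow_cost N' c1 g"
      "flow_cost N' c1 g < flow_cost N' c1 f''"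
    then show False using between by fastforce
  next
    fix g assume "feasible_flow N g" "flow_image N c1 c2 g \<in> closed_segment p q"
      "flow_cost N c1 (extend_flow (fixed_arcs N rc) f0 f') < flow_cost N c1 g"
      "flow_cost N c1 g < flow_cost N c1 (extend_flow (fixed_arcs N rc) f0 f'')"
    \<comment> \<open>All three costs exceed those in \<open>N'\<close> by the same constant from
      the fixed arcs.\<close>
    then show False
      using between[of g] lower_cost[of g] by (simp add: flow_cost_extend_flow[OF fin] flip: assms(8))
  qed
qed

end
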